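(* Let $N$ be a positive integer whose trajectory under the Collatz function reaches $1$, let $m$ be the number of odd numbers in the Collatz trajectory of $N$, and let $\ell_1,\dots,\ell_m$ be the lengths of the successive blocks of the trajectory, each ending at an odd number. Then $P_N(-2)=0$ if and only if $\ell_i$ is even for all $i=1,\dots,m$.
   Context: The Collatz function is $c(N)=\frac{3N+1}{2}$ for $N$ odd and $c(N)=\frac N2$ for $N$ even. Let $N$ be a positive integer whose trajectory $N, c(N), c(c(N)),\dots$ reaches $1$. The total stopping time $n$ of $N$ is the least $k\ge 0$ such that the $k$-th iterate of $N$ under $c$ equals $1$. Set $c^0(N)=N$, $c^k(N)=c(c^{k-1}(N))$ for $1\le k\le n$, and $c^k(N)=0$ for $k>n$. The $N$-th Collatz polynomial is $P_N(z)=\sum_{k=0}^{n}c^k(N)z^k$. The Collatz trajectory of $N$ is the finite sequence $N, c(N),\dots,c^n(N)=1$. Let $m=m(N)$ be the number of odd numbers in it, and let $N_i$ be the $i$-th odd number appearing in it ($1\le i\le m$, so $N_m=1$). The trajectory is the concatenation, for $i=1,\dots,m$ in order, of consecutive blocks $2^{\ell_i-1}N_i, 2^{\ell_i-2}N_i,\dots,N_i$, where the $i$-th block ends at $N_i$ and has length $\ell_i\geq 1$; this defines $\ell_1,\dots,\ell_m$. *)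

theory Defs
  imports Complex_Main "HOL-Computational_Algebra.Polynomial"
begin

definition collatz :: "nat \<Rightarrow> nat" where
  "collatz N = (if odd N then (3 * N + 1) div 2 else N div 2)"

definition reaches_one :: "nat \<Rightarrow> bool" where
  "reaches_one N \<longleftrightarrow> (\<exists>k. (collatz ^^ k) N = 1)"

definition total_stopping_time :: "nat \<Rightarrow> nat" where
  "total_stopping_time N = (LEAST k. (collatz ^^ k) N = 1)"

definition collatz_poly :: "nat \<Rightarrow> complex poly" where
  "collatz_poly N = (\<Sum>k\<le>total_stopping_time N. monom (of_nat ((collatz ^^ k) N)) k)"

definition collatz_trajectory :: "nat \<Rightarrow> nat list" where
  "collatz_trajectory N = map (\<lambda>k. (collatz ^^ k) N) [0..<Suc (total_stopping_time N)]"

definition odd_terms :: "nat \<Rightarrow> nat list" where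
  "odd_terms N = filter odd (collatz_trajectory N)"

definition num_odd :: "nat \<Rightarrow> nat" where
  "num_odd N = length (odd_terms N)"

text \<open>The list \<open>[2 ^ (l - 1) * a, 2 ^ (l - 2) * a, \<dots>, a]\<close> of length \<open>l\<close>.\<close>

definition halving_block :: "nat \<Rightarrow> nat \<Rightarrow> nat list" where
  "halving_block l a = map (\<lambda>j. 2 ^ j * a) (rev [0..<l])"

definition is_block_lengths :: "nat \<Rightarrow> nat list \<Rightarrow> bool" where
  "is_block_lengths N ls \<longleftrightarrow>
     length ls = num_odd N \<and> (\<forall>l\<in>set ls. 1 \<le> l) \<and>
     collatz_trajectory N = concat (map2 halving_block ls (odd_terms N))"

text \<open>Well defined for every \<open>N\<close> that reaches 1: see \<open>ex1_block_lengths\<close> below.\<close>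

definition block_lengths :: "nat \<Rightarrow> nat list" where
  "block_lengths N = (THE ls. is_block_lengths N ls)"

text \<open>Blocks are numbered from 1.\<close>

definition block_length :: "nat \<Rightarrow> nat \<Rightarrow> nat" where
  "block_length N i = block_lengths N ! (i - 1)"

lemma halving_block_Suc: "halving_block (Suc l) a = 2 ^ l * a # halving_block l a"
  by (simp add: halving_block_def)

lemma halving_block_0: "halving_block 0 a = []"
  by (simp add: halving_block_def)

lemma takeWhile_halving_block:
  assumes "odd a"
  shows "length (takeWhile even (halving_block (Suc k) a @ xs)) = k"
proof (induction k)
  case 0
  then show ?case using assms by (simp add: halving_block_Suc)
next
  case (Suc k)
  then show ?case by (subst halving_block_Suc) simp
qed

lemma positive_list_Cons:
  assumes "length ls = Suc n" "\<forall>l\<in>set ls. (1 :: nat) \<le> l"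
  obtains k r where "ls = Suc k # r"
proof -
  obtain l r where l: "ls = l # r" using assms(1) by (cases ls) simp_all
  moreover obtain k where "l = Suc k" using assms(2) l by (cases l) simp_all
  ultimately show ?thesis using that by simp
qed

lemma concat_halving_blocks_unique:
  assumes "length ls = length as" "length ls' = length as" "\<forall>a\<in>set as. odd a"
    "\<forall>l\<in>set ls. 1 \<le> l" "\<forall>l\<in>set ls'. 1 \<le> l"
    "concat (map2 halving_block ls as) = concat (map2 halving_block ls' as)"
  shows "ls = ls'"
  using assms
proof (induction as arbitrary: ls ls')
  case Nil
  then show ?case by simp
next
  case (Cons a as)
  obtain k r where ls: "ls = Suc k # r"
    using positive_list_Cons[of ls "length as"] Cons.prems(1,4) by (metis length_Cons)
  obtain k' r' where ls': "ls' = Suc k' # r'"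
    using positive_list_Cons[of ls' "length as"] Cons.prems(2,5) by (metis length_Cons)
  have eq: "halving_block (Suc k) a @ concat (map2 halving_block r as) =
      halving_block (Suc k') a @ concat (map2 halving_block r' as)"
    using Cons.prems(6) ls ls' by simp
  have "odd a" using Cons.prems(3) by simp
  then have "k = k'"
    using takeWhile_halving_block[of a k "concat (map2 halving_block r as)"]
      takeWhile_halving_block[of a k' "concat (map2 halving_block r' as)"]
    unfolding eq by simp
  moreover have "r = r'"
  proof (rule Cons.IH)
    show "concat (map2 halving_block r as) = concat (map2 halving_block r' as)"
      using eq unfolding \<open>k = k'\<close> by simp
  qed (use Cons.prems(1-5) ls ls' in simp_all)
  ultimately show ?case using ls ls' by simp
qed

lemma concat_halving_blocks_exists:
  assumes "xs \<noteq> []" "odd (last xs)"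
    "\<And>i. Suc i < length xs \<Longrightarrow> even (xs ! i) \<Longrightarrow> xs ! i = 2 * xs ! Suc i"
  shows "\<exists>ls. length ls = length (filter odd xs) \<and> (\<forall>l\<in>set ls. 1 \<le> l) \<and>
           xs = concat (map2 halving_block ls (filter odd xs))"
  using assms
proof (induction xs)
  case Nil
  then show ?case by simp
next
  case (Cons x xs)
  show ?case
  proof (cases "xs = []")
    case True
    then show ?thesis using Cons.prems
      by (intro exI[of _ "[Suc 0]"]) (simp add: halving_block_Suc halving_block_0)
  next
    case False
    have "xs ! i = 2 * xs ! Suc i" if "Suc i < length xs" "even (xs ! i)" for i
      using Cons.prems(3)[of "Suc i"] that by simp
    then obtain ls where ls: "length ls = length (filter odd xs)" "\<forall>l\<in>set ls. 1 \<le> l"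
        "xs = concat (map2 halving_block ls (filter odd xs))"
      using Cons.IH False Cons.prems(2) by auto
    show ?thesis
    proof (cases "odd x")
      case True
      then show ?thesis using ls
        by (intro exI[of _ "Suc 0 # ls"]) (simp add: halving_block_Suc halving_block_0)
    next
      case even: False
      obtain a as where as: "filter odd xs = a # as"
        using False ls(3) by (cases "filter odd xs") auto
      obtain k r where r: "ls = Suc k # r"
        using positive_list_Cons[of ls "length as"] ls(1,2) as by (metis length_Cons)
      have xs: "xs = halving_block (Suc k) a @ concat (map2 halving_block r as)"
        using ls(3) as r by simp
      then have hd: "xs ! 0 = 2 ^ k * a" by (simp add: halving_block_Suc)
      have "x = 2 * xs ! 0" using Cons.prems(3)[of 0] False even by simp
      then have x: "x # xs = halving_block (Suc (Suc k)) a @ concat (map2 halving_block r as)"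
        using hd xs by (simp add: halving_block_Suc[of "Suc k"])
      have f: "filter odd (x # xs) = a # as" using as even by simp
      show ?thesis
      proof (intro exI conjI)
        show "length (Suc (Suc k) # r) = length (filter odd (x # xs))"
          unfolding f using ls(1) as r by simp
        show "\<forall>l\<in>set (Suc (Suc k) # r). 1 \<le> l" using ls(2) r by simp
        show "x # xs = concat (map2 halving_block (Suc (Suc k) # r) (filter odd (x # xs)))"
          unfolding f using x by simp
      qed
    qed
  qed
qed

lemma ex1_block_lengths:
  assumes "reaches_one N"
  shows "\<exists>!ls. is_block_lengths N ls"
proof -
  let ?xs = "collatz_trajectory N"
  have one: "(collatz ^^ total_stopping_time N) N = 1"
    using assms LeastI_ex[of "\<lambda>k. (collatz ^^ k) N = 1"]
    unfolding reaches_one_def total_stopping_time_def by blast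
  have "?xs \<noteq> []" "odd (last ?xs)"
    using one by (simp_all add: collatz_trajectory_def)
  moreover have "?xs ! i = 2 * ?xs ! Suc i" if "Suc i < length ?xs" "even (?xs ! i)" for i
  proof -
    have nth: "?xs ! j = (collatz ^^ j) N" if "j < length ?xs" for j
      using that nth_map[of j "[0..<Suc (total_stopping_time N)]"]
      by (simp add: collatz_trajectory_def del: upt_Suc)
    show ?thesis using that nth[of i] nth[of "Suc i"] by (simp add: collatz_def)
  qed
  ultimately have "\<exists>ls. is_block_lengths N ls"
    unfolding is_block_lengths_def num_odd_def odd_terms_def
    by (rule concat_halving_blocks_exists)
  moreover have "ls = ls'" if "is_block_lengths N ls" "is_block_lengths N ls'" for ls ls'
  proof (rule concat_halving_blocks_unique)
    show "\<forall>a\<in>set (odd_terms N). odd a" by (simp add: odd_terms_def)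
    show "concat (map2 halving_block ls (odd_terms N)) = concat (map2 halving_block ls' (odd_terms N))"
      using that unfolding is_block_lengths_def by simp
  qed (use that in \<open>simp_all add: is_block_lengths_def num_odd_def\<close>)
  ultimately show ?thesis by blast
qed

end

theory Submission
  imports Defs
begin

text \<open>
  At \<open>z = -2\<close> the summands \<open>c * z ^ j\<close> that come from the terms \<open>c\<close> of one block
  \<open>2 ^ (l - 1) * a, \<dots>, a\<close> all have the same absolute value, because \<open>z ^ j\<close> gains the factor 2 that each halving loses, and their signs alternate. A block of
  even length thus contributes 0, while a block of odd length that starts at exponent \<open>s\<close>
  contributes \<open>\<plusminus> 2 ^ (s + l - 1) * a\<close> (lemma \<open>horner_sum_halving_block\<close>).

  If all lengths are even, everything cancels. Otherwise the first block of odd length contributes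
  an odd multiple of \<open>2 ^ e\<close>, where \<open>e\<close> is the position of its last term, and everything after it
  is a multiple of \<open>2 ^ (e + 1)\<close>; so the total is not 0. Lemma
  \<open>horner_sum_halving_blocks_eq_0_iff\<close> carries out this 2-adic argument by peeling off one block
  at a time. It works over the integers, and the value of the polynomial is the image of
  such an integer.
\<close>

lemma horner_sum_halving_block:
  "horner_sum int (- 2) (halving_block l a) = (if odd l then 2 ^ (l - 1) * int a else 0)"
proof (induction l)
  case 0
  then show ?case by (simp add: halving_block_0)
next
  case (Suc l)
  then show ?case by (cases l) (simp_all add: halving_block_Suc halving_block_0)
qed

text \<open>
  For a first block of odd length \<open>Suc k\<close> and a remaining sum \<open>R\<close>, the total is
  \<open>2 ^ k * (a - 2 * R)\<close>, whose second factor is odd; for a first block of even length \<open>l\<close> it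
  is \<open>2 ^ l * R\<close>.
\<close>

lemma horner_sum_halving_blocks_eq_0_iff:
  assumes "length ls = length as" "\<forall>a\<in>set as. odd a"
  shows "horner_sum int (- 2) (concat (map2 halving_block ls as)) = 0 \<longleftrightarrow> (\<forall>l\<in>set ls. even l)"
  using assms
proof (induction ls as rule: list_induct2)
  case Nil
  then show ?case by simp
next
  case (Cons l ls a as)
  define R where "R = horner_sum int (- 2) (concat (map2 halving_block ls as))"
  have len: "length (halving_block l a) = l" by (simp add: halving_block_def)
  have total: "horner_sum int (- 2) (concat (map2 halving_block (l # ls) (a # as))) =
      (if odd l then 2 ^ (l - 1) * int a else 0) + (- 2) ^ l * R"
    by (simp add: horner_sum_append horner_sum_halving_block len R_def)
  show ?case
  proof (cases "even l")
    case True
    then show ?thesis using Cons unfolding total R_def by simp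
  next
    case False
    then obtain k where k: "l = Suc k" "even k" by (cases l) auto
    have "odd (int a - 2 * R)" using Cons.prems by simp
    then have "int a - 2 * R \<noteq> 0" by (metis even_zero)
    then have "2 ^ k * (int a - 2 * R) \<noteq> 0" by simp
    then show ?thesis unfolding total using k by (simp add: algebra_simps)
  qed
qed

lemma poly_collatz_poly_of_int:
  "poly (collatz_poly N) (of_int z) = of_int (horner_sum int z (collatz_trajectory N))"
proof -
  let ?n = "total_stopping_time N"
  have "collatz_trajectory N ! k = (collatz ^^ k) N" if "k < Suc ?n" for k
    using that nth_map[of k "[0..<Suc ?n]"] by (simp add: collatz_trajectory_def del: upt_Suc)
  then have "horner_sum int z (collatz_trajectory N) = (\<Sum>k<Suc ?n. int ((collatz ^^ k) N) * z ^ k)"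
    unfolding horner_sum_eq_sum atLeast0LessThan
    by (intro sum.cong) (auto simp: collatz_trajectory_def simp del: upt_Suc)
  then show ?thesis
    by (simp add: collatz_poly_def poly_sum poly_monom lessThan_Suc_atMost del: sum.lessThan_Suc)
qed

theorem mainTheorem3:
  fixes N :: nat
  assumes "N > 0" and "reaches_one N"
  shows "poly (collatz_poly N) (-2) = 0 \<longleftrightarrow> (\<forall>i\<in>{1..num_odd N}. even (block_length N i))"
proof -
  have "is_block_lengths N (block_lengths N)"
    unfolding block_lengths_def by (rule theI'[OF ex1_block_lengths[OF assms(2)]])
  then have len: "length (block_lengths N) = num_odd N"
    and traj: "collatz_trajectory N = concat (map2 halving_block (block_lengths N) (odd_terms N))"
    by (simp_all add: is_block_lengths_def)
  have "poly (collatz_poly N) (- 2) = 0 \<longleftrightarrow> horner_sum int (- 2) (collatz_trajectory N) = 0"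
    using poly_collatz_poly_of_int[of N "- 2"] by simp
  also have "\<dots> \<longleftrightarrow> (\<forall>l\<in>set (block_lengths N). even l)"
    unfolding traj using len
    by (intro horner_sum_halving_blocks_eq_0_iff) (simp_all add: num_odd_def odd_terms_def)
  also have "\<dots> \<longleftrightarrow> (\<forall>j<num_odd N. even (block_lengths N ! j))"
    using len by (metis in_set_conv_nth)
  also have "\<dots> \<longleftrightarrow> (\<forall>i\<in>{1..num_odd N}. even (block_length N i))"
    unfolding block_length_def
  proof (intro iffI ballI allI impI)
    fix j assume "\<forall>i\<in>{1..num_odd N}. even (block_lengths N ! (i - 1))" "j < num_odd N"
    then show "even (block_lengths N ! j)" by (auto dest: bspec[of _ _ "Suc j"])
  qed auto
  finally show ?thesis .
qed

end
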